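(* Let $(A,R,{}')$ be a directed relational system with involution, let $|_A$ be a Sheffer operation on $A$ assigned to it, and define $$(x,y)\,|_B\,(z,v):=\big(y'|_Av',\,(x|_Az)'\big)$$ for all $(x,y),(z,v)\in A^2$. Then $|_B$ is a Sheffer operation on $A^2$ assigned to the twist-product of $(A,R)$.
   Context: For a binary relation $R$ on a non-empty set $A$ and $a,b\in A$, let $U(a,b):=\{x\in A\mid (a,x),(b,x)\in R\}$ and $L(a,b):=\{x\in A\mid (x,a),(x,b)\in R\}$. A directed relational system with involution is a triple $(A,R,{}')$ where $A$ is a non-empty set, $R$ is a reflexive binary relation on $A$, $U(x,y)\neq\emptyset$ and $L(x,y)\neq\emptyset$ for all $x,y\in A$, and $'$ is a unary operation on $A$ such that $x''=x$ for all $x\in A$ and $(x,y)\in R$ implies $(y',x')\in R$ for all $x,y\in A$. A Sheffer operation on a non-empty set $A$ is a binary operation $|$ on $A$ with $(x|y)|(x|x)=x$ and $(x|y)|(y|y)=y$ for all $x,y\in A$. A binary operation $|$ on $A$ is assigned to the directed relational system with involution $(A,R,{}')$ if for all $x,y\in A$: $x|y=y'$ if $(x',y')\in R$, and $x|y$ is an (arbitrary) element of $U(x',y')$ otherwise. (Every assigned operation is a Sheffer operation.) The twist-product of $(A,R)$ is $(A^2,S,{}^* )$ where $S:=\{((x,y),(z,v))\in(A^2)^2\mid (x,z),(v,y)\in R\}$ and $(x,y)^*:=(y,x)$ for all $(x,y)\in A^2$; for $(A,R)$ reflexive and directed it is a directed relational system with involution $^*$. *)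

theory Defs
  imports Main
begin

definition binary_op_on :: "'a set \<Rightarrow> ('a \<Rightarrow> 'a \<Rightarrow> 'a) \<Rightarrow> bool" where
  "binary_op_on A f \<longleftrightarrow> (\<forall>x\<in>A. \<forall>y\<in>A. f x y \<in> A)"

definition upper_cone :: "'a set \<Rightarrow> 'a rel \<Rightarrow> 'a \<Rightarrow> 'a \<Rightarrow> 'a set" where
  "upper_cone A R a b = {x \<in> A. (a, x) \<in> R \<and> (b, x) \<in> R}"

definition lower_cone :: "'a set \<Rightarrow> 'a rel \<Rightarrow> 'a \<Rightarrow> 'a \<Rightarrow> 'a set" where
  "lower_cone A R a b = {x \<in> A. (x, a) \<in> R \<and> (x, b) \<in> R}"

(* refl_on does not entail that R is a relation on A, so R \<subseteq> A \<times> A is a separate conjunct. *)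
definition directed_involution_system :: "'a set \<Rightarrow> 'a rel \<Rightarrow> ('a \<Rightarrow> 'a) \<Rightarrow> bool" where
  "directed_involution_system A R inv' \<longleftrightarrow>
     A \<noteq> {} \<and> R \<subseteq> A \<times> A \<and> refl_on A R \<and>
     (\<forall>x\<in>A. \<forall>y\<in>A. upper_cone A R x y \<noteq> {} \<and> lower_cone A R x y \<noteq> {}) \<and>
     (\<forall>x\<in>A. inv' x \<in> A) \<and> (\<forall>x\<in>A. inv' (inv' x) = x) \<and>
     (\<forall>x\<in>A. \<forall>y\<in>A. (x, y) \<in> R \<longrightarrow> (inv' y, inv' x) \<in> R)"

definition sheffer_operation :: "'a set \<Rightarrow> ('a \<Rightarrow> 'a \<Rightarrow> 'a) \<Rightarrow> bool" where
  "sheffer_operation A f \<longleftrightarrow> A \<noteq> {} \<and> binary_op_on A f \<and>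
     (\<forall>x\<in>A. \<forall>y\<in>A. f (f x y) (f x x) = x \<and> f (f x y) (f y y) = y)"

definition assigned_to ::
    "'a set \<Rightarrow> 'a rel \<Rightarrow> ('a \<Rightarrow> 'a) \<Rightarrow> ('a \<Rightarrow> 'a \<Rightarrow> 'a) \<Rightarrow> bool" where
  "assigned_to A R inv' f \<longleftrightarrow> binary_op_on A f \<and>
     (\<forall>x\<in>A. \<forall>y\<in>A.
        if (inv' x, inv' y) \<in> R then f x y = inv' y
        else f x y \<in> upper_cone A R (inv' x) (inv' y))"

definition twist_rel :: "'a set \<Rightarrow> 'a rel \<Rightarrow> ('a \<times> 'a) rel" where
  "twist_rel A R = {((x, y), (z, v)) | x y z v.
     x \<in> A \<and> y \<in> A \<and> z \<in> A \<and> v \<in> A \<and> (x, z) \<in> R \<and> (v, y) \<in> R}"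

definition twist_inv :: "'a \<times> 'a \<Rightarrow> 'a \<times> 'a" where
  "twist_inv = (\<lambda>(x, y). (y, x))"

definition twist_op ::
    "('a \<Rightarrow> 'a) \<Rightarrow> ('a \<Rightarrow> 'a \<Rightarrow> 'a) \<Rightarrow> 'a \<times> 'a \<Rightarrow> 'a \<times> 'a \<Rightarrow> 'a \<times> 'a" where
  "twist_op inv' f = (\<lambda>(x, y) (z, v). (f (inv' y) (inv' v), inv' (f x z)))"

lemma directed_involution_system_twist:
  assumes "directed_involution_system A R inv'"
  shows "directed_involution_system (A \<times> A) (twist_rel A R) twist_inv"
proof -
  have cones: "upper_cone (A \<times> A) (twist_rel A R) (x, y) (z, v) \<noteq> {}"
              "lower_cone (A \<times> A) (twist_rel A R) (x, y) (z, v) \<noteq> {}"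
    if xyzv: "x \<in> A" "y \<in> A" "z \<in> A" "v \<in> A" for x y z v
  proof -
    have "upper_cone A R x z \<noteq> {}" "lower_cone A R y v \<noteq> {}"
        "lower_cone A R x z \<noteq> {}" "upper_cone A R y v \<noteq> {}"
      using assms xyzv by (auto simp: directed_involution_system_def)
    then obtain a b c d where "a \<in> upper_cone A R x z" "b \<in> lower_cone A R y v"
        "c \<in> lower_cone A R x z" "d \<in> upper_cone A R y v"
      by (meson ex_in_conv)
    then have "(a, b) \<in> upper_cone (A \<times> A) (twist_rel A R) (x, y) (z, v)"
        "(c, d) \<in> lower_cone (A \<times> A) (twist_rel A R) (x, y) (z, v)"
      using xyzv by (auto simp: upper_cone_def lower_cone_def twist_rel_def)
    then show "upper_cone (A \<times> A) (twist_rel A R) (x, y) (z, v) \<noteq> {}"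
        "lower_cone (A \<times> A) (twist_rel A R) (x, y) (z, v) \<noteq> {}" by blast+
  qed
  have "\<forall>p\<in>A \<times> A. \<forall>q\<in>A \<times> A. upper_cone (A \<times> A) (twist_rel A R) p q \<noteq> {} \<and>
      lower_cone (A \<times> A) (twist_rel A R) p q \<noteq> {}"
    by (simp add: cones split_paired_all)
  moreover have "A \<noteq> {}" and "refl_on A R"
    using assms by (auto simp: directed_involution_system_def)
  then have "A \<times> A \<noteq> {}" "refl_on (A \<times> A) (twist_rel A R)"
    "twist_rel A R \<subseteq> (A \<times> A) \<times> (A \<times> A)"
    by (auto simp: twist_rel_def refl_on_def)
  moreover have "\<forall>p\<in>A \<times> A. twist_inv p \<in> A \<times> A" "\<forall>p\<in>A \<times> A. twist_inv (twist_inv p) = p"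
    "\<forall>p\<in>A \<times> A. \<forall>q\<in>A \<times> A. (p, q) \<in> twist_rel A R \<longrightarrow> (twist_inv q, twist_inv p) \<in> twist_rel A R"
    by (auto simp: twist_inv_def twist_rel_def)
  ultimately show ?thesis
    unfolding directed_involution_system_def by blast
qed

end

theory Submission
  imports Defs
begin

text \<open>
  Being assigned is the only thing that has to be checked. Since the twist-product is again a
  directed relational system with involution, and every operation assigned to such a system is a
  Sheffer operation (\<open>assigned_to_imp_sheffer_operation\<close>), the Sheffer identities for the
  operation on pairs follow without a separate computation.

  The operation on pairs is assigned for the following reason. In the twist-product, an upper bound
  of \<open>(y, x)\<close> and \<open>(v, z)\<close> is an upper bound of \<open>y, v\<close> paired with a lower bound of \<open>x, z\<close>. The
  element \<open>y' | v'\<close> always is an upper bound of \<open>y'' = y\<close> and \<open>v'' = v\<close>; the element \<open>x | z\<close> always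
  is an upper bound of \<open>x'\<close> and \<open>z'\<close>, so that \<open>(x | z)'\<close> is a lower bound of \<open>x\<close> and \<open>z\<close>. If
  moreover \<open>(y, x)\<close> is related to \<open>(v, z)\<close>, then \<open>y\<close> is related to \<open>v\<close> and \<open>x'\<close> to \<open>z'\<close>, and both
  components take the values \<open>v\<close> and \<open>z'' = z\<close> that the definition prescribes.
\<close>

text \<open>
  In the first case of the definition of an assigned operation, the prescribed value \<open>y'\<close> is itself
  an upper bound of \<open>x'\<close> and \<open>y'\<close>, by reflexivity; so both cases yield upper bounds.
\<close>

lemma assigned_to_in_upper_cone:
  assumes sys: "directed_involution_system A R inv'" and asg: "assigned_to A R inv' f"
    and xy: "x \<in> A" "y \<in> A"
  shows "f x y \<in> upper_cone A R (inv' x) (inv' y)"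
proof (cases "(inv' x, inv' y) \<in> R")
  case True
  then have "f x y = inv' y" using asg xy by (auto simp: assigned_to_def)
  moreover have "inv' y \<in> A" "(inv' y, inv' y) \<in> R"
    using sys xy by (auto simp: directed_involution_system_def refl_on_def)
  ultimately show ?thesis using True by (simp add: upper_cone_def)
next
  case False
  then show ?thesis using asg xy by (auto simp: assigned_to_def)
qed

lemma assigned_to_eq:
  "assigned_to A R inv' f \<Longrightarrow> x \<in> A \<Longrightarrow> y \<in> A \<Longrightarrow> (inv' x, inv' y) \<in> R \<Longrightarrow> f x y = inv' y"
  by (auto simp: assigned_to_def)

text \<open>
  Reflexivity gives \<open>x | x = x'\<close>. As \<open>x | y\<close> lies above \<open>x'\<close>, its involute lies below \<open>x = (x')'\<close>,
  so \<open>(x | y) | x'\<close> falls under the first case of the definition and equals \<open>x'' = x\<close>. The argument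
  for \<open>y\<close> is the same, since \<open>x | y\<close> also lies above \<open>y'\<close>.
\<close>

lemma assigned_to_imp_sheffer_operation:
  assumes sys: "directed_involution_system A R inv'" and asg: "assigned_to A R inv' f"
  shows "sheffer_operation A f"
proof -
  have recover: "f u (f w w) = w" if u: "u \<in> A" "(inv' w, u) \<in> R" and w: "w \<in> A" for u w
  proof -
    have inv: "inv' w \<in> A" "inv' (inv' w) = w" "(inv' w, inv' w) \<in> R"
      using sys w by (auto simp: directed_involution_system_def refl_on_def)
    have "(inv' u, inv' (inv' w)) \<in> R"
      using sys u inv(1) by (auto simp: directed_involution_system_def)
    then have "f u (inv' w) = w" using assigned_to_eq[OF asg u(1) inv(1)] inv(2) by simp
    moreover have "f w w = inv' w" using assigned_to_eq[OF asg w w inv(3)] .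
    ultimately show ?thesis by simp
  qed
  have "f (f x y) (f x x) = x \<and> f (f x y) (f y y) = y" if "x \<in> A" "y \<in> A" for x y
    using assigned_to_in_upper_cone[OF sys asg that] recover that by (simp add: upper_cone_def)
  moreover have "A \<noteq> {}" "binary_op_on A f"
    using sys asg by (auto simp: directed_involution_system_def assigned_to_def)
  ultimately show ?thesis by (simp add: sheffer_operation_def)
qed

lemma assigned_to_twist_op:
  assumes sys: "directed_involution_system A R inv'" and asg: "assigned_to A R inv' f"
  shows "assigned_to (A \<times> A) (twist_rel A R) twist_inv (twist_op inv' f)"
proof -
  have inv: "inv' x \<in> A" "inv' (inv' x) = x" if "x \<in> A" for x
    using sys that by (auto simp: directed_involution_system_def)
  have anti: "(inv' y, inv' x) \<in> R" if "x \<in> A" "y \<in> A" "(x, y) \<in> R" for x y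
    using sys that by (auto simp: directed_involution_system_def)
  have upper: "f (inv' y) (inv' v) \<in> upper_cone A R y v" if "y \<in> A" "v \<in> A" for y v
    using assigned_to_in_upper_cone[OF sys asg, of "inv' y" "inv' v"] inv that by simp
  have lower: "inv' (f x z) \<in> lower_cone A R x z" if "x \<in> A" "z \<in> A" for x z
  proof -
    have "f x z \<in> A" "(inv' x, f x z) \<in> R" "(inv' z, f x z) \<in> R"
      using assigned_to_in_upper_cone[OF sys asg that] by (auto simp: upper_cone_def)
    then show ?thesis
      using anti[of "inv' x" "f x z"] anti[of "inv' z" "f x z"] inv that
      by (simp add: lower_cone_def)
  qed
  have cone: "twist_op inv' f p q \<in> upper_cone (A \<times> A) (twist_rel A R) (twist_inv p) (twist_inv q)"
    if "p \<in> A \<times> A" "q \<in> A \<times> A" for p q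
    using upper[of "snd p" "snd q"] lower[of "fst p" "fst q"] that
    by (auto simp: upper_cone_def lower_cone_def twist_rel_def twist_inv_def twist_op_def)
  have eq: "twist_op inv' f p q = twist_inv q"
    if "p \<in> A \<times> A" "q \<in> A \<times> A" "(twist_inv p, twist_inv q) \<in> twist_rel A R" for p q
  proof -
    obtain x y z v where pq: "p = (x, y)" "q = (z, v)" by (metis surj_pair)
    with that have mem: "x \<in> A" "y \<in> A" "z \<in> A" "v \<in> A" and rel: "(y, v) \<in> R" "(z, x) \<in> R"
      by (auto simp: twist_rel_def twist_inv_def)
    have "f (inv' y) (inv' v) = v"
      using assigned_to_eq[OF asg, of "inv' y" "inv' v"] inv mem rel by simp
    moreover have "inv' (f x z) = z"
      using assigned_to_eq[OF asg mem(1,3) anti[OF mem(3,1) rel(2)]] inv mem by simp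
    ultimately show ?thesis by (simp add: pq twist_op_def twist_inv_def)
  qed
  have "binary_op_on (A \<times> A) (twist_op inv' f)"
    using cone unfolding binary_op_on_def upper_cone_def by blast
  with cone eq show ?thesis unfolding assigned_to_def by simp
qed

theorem theorem5p5:
  fixes A :: "'a set" and R :: "'a rel" and inv' :: "'a \<Rightarrow> 'a"
    and shA :: "'a \<Rightarrow> 'a \<Rightarrow> 'a"
  assumes "directed_involution_system A R inv'"
    and "sheffer_operation A shA"
    and "assigned_to A R inv' shA"
  shows "sheffer_operation (A \<times> A) (twist_op inv' shA) \<and>
         assigned_to (A \<times> A) (twist_rel A R) twist_inv (twist_op inv' shA)"
  using assigned_to_twist_op[OF assms(1,3)] directed_involution_system_twist[OF assms(1)]
    assigned_to_imp_sheffer_operation by blast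

end
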